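(* For every graph $G$, $$\mathrm{mis}(G)\;\leq\;\max_{\sigma}\mathrm{fix}(G_\sigma)\;\leq\;\left(\frac{3}{2}\right)^{m(G)}\mathrm{mis}(G),$$ where the maximum is over all repartitions of signs $\sigma$ in $G$, and $m(G)$ is the maximum size of a matching $M$ of $G$ such that every edge of $M$ is contained in an induced copy of $C_4$ (in $G$) that contains no other edge of $M$.
   Context: A graph means a finite loop-less symmetric digraph, i.e. each undirected edge $\{u,v\}$ of a finite simple graph is viewed as the two arcs $uv$ and $vu$; graph-theoretic notions (matching, independent set, induced subgraph) refer to the undirected graph. $C_4$ is the undirected cycle of length 4. $\mathrm{mis}(G)$ is the number of (inclusion-)maximal independent sets of $G$. A repartition of signs $\sigma$ in $G$ assigns to each arc a sign, positive or negative (zero signs are not allowed); the arcs $uv$ and $vu$ may get different signs. $G_\sigma$ is $G$ together with $\sigma$. With $V$ the vertex set of $G$, the conjunctive network on $G_\sigma$ is the map $f:\{0,1\}^V\to\{0,1\}^V$ with $$f_v(x)=\prod_{u:\ uv\text{ is a positive arc}}x_u\ \prod_{u:\ uv\text{ is a negative arc}}(1-x_u)\qquad(v\in V),$$ an empty product being 1. $\mathrm{fix}(G_\sigma)$ is the number of $x\in\{0,1\}^V$ with $f(x)=x$. *)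

theory Defs
  imports Complex_Main "HOL-Library.FuncSet" "Graph_Theory.Graph_Theory"
begin

text \<open>
  A graph is a \<^locale>\<open>pair_graph\<close>: a finite, loop-free, symmetric digraph whose arcs are pairs of
  vertices. An undirected edge is the two-element set of the ends of an arc.
\<close>

definition edges :: "'a pair_pre_digraph \<Rightarrow> 'a set set" where
  "edges G = {{u, v} | u v. (u, v) \<in> parcs G}"

definition independent_set :: "'a pair_pre_digraph \<Rightarrow> 'a set \<Rightarrow> bool" where
  "independent_set G S \<longleftrightarrow> S \<subseteq> pverts G \<and> (\<forall>u\<in>S. \<forall>v\<in>S. (u, v) \<notin> parcs G)"

definition maximal_independent_set :: "'a pair_pre_digraph \<Rightarrow> 'a set \<Rightarrow> bool" where
  "maximal_independent_set G S \<longleftrightarrow>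
     independent_set G S \<and> (\<forall>T. independent_set G T \<and> S \<subseteq> T \<longrightarrow> T = S)"

definition mis :: "'a pair_pre_digraph \<Rightarrow> nat" where
  "mis G = card {S. maximal_independent_set G S}"

definition matching :: "'a pair_pre_digraph \<Rightarrow> 'a set set \<Rightarrow> bool" where
  "matching G M \<longleftrightarrow> M \<subseteq> edges G \<and> pairwise disjnt M"

definition C4 :: "nat pair_pre_digraph" where
  "C4 = \<lparr> pverts = {..<4},
          parcs = {(i, j). i < 4 \<and> j < 4 \<and> (j = (i + 1) mod 4 \<or> i = (j + 1) mod 4)} \<rparr>"

definition induced_C4 :: "'a pair_pre_digraph \<Rightarrow> 'a pair_pre_digraph \<Rightarrow> bool" where
  "induced_C4 H G \<longleftrightarrow>
     induced_subgraph (with_proj H) (with_proj G) \<and> digraph_iso (with_proj C4) (with_proj H)"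

definition C4_matching :: "'a pair_pre_digraph \<Rightarrow> 'a set set \<Rightarrow> bool" where
  "C4_matching G M \<longleftrightarrow> matching G M \<and>
     (\<forall>e\<in>M. \<exists>H. induced_C4 H G \<and> e \<in> edges H \<and> (\<forall>e'\<in>M. e' \<in> edges H \<longrightarrow> e' = e))"

definition C4_matching_number :: "'a pair_pre_digraph \<Rightarrow> nat" where
  "C4_matching_number G = Max (card ` {M. C4_matching G M})"

datatype sign = Positive | Negative

text \<open>
  Repartitions of signs and configurations are extensional functions, so that each one is
  represented exactly once; this matters for counting fixed points.
\<close>

definition sign_repartitions :: "'a pair_pre_digraph \<Rightarrow> ('a \<times> 'a \<Rightarrow> sign) set" where
  "sign_repartitions G = parcs G \<rightarrow>\<^sub>E UNIV"

definition configurations :: "'a pair_pre_digraph \<Rightarrow> ('a \<Rightarrow> int) set" where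
  "configurations G = pverts G \<rightarrow>\<^sub>E {0, 1}"

definition conjunctive_network ::
  "'a pair_pre_digraph \<Rightarrow> ('a \<times> 'a \<Rightarrow> sign) \<Rightarrow> ('a \<Rightarrow> int) \<Rightarrow> 'a \<Rightarrow> int" where
  "conjunctive_network G \<sigma> x = (\<lambda>v\<in>pverts G.
     (\<Prod>u\<in>{u. (u, v) \<in> parcs G \<and> \<sigma> (u, v) = Positive}. x u) *
     (\<Prod>u\<in>{u. (u, v) \<in> parcs G \<and> \<sigma> (u, v) = Negative}. 1 - x u))"

definition num_fixed_points :: "'a pair_pre_digraph \<Rightarrow> ('a \<times> 'a \<Rightarrow> sign) \<Rightarrow> nat" where
  "num_fixed_points G \<sigma> = card {x \<in> configurations G. conjunctive_network G \<sigma> x = x}"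

definition max_fixed_points :: "'a pair_pre_digraph \<Rightarrow> nat" where
  "max_fixed_points G = Max (num_fixed_points G ` sign_repartitions G)"

text \<open>The maxima and cardinalities above are taken over finite sets, nonempty for the maxima.\<close>

lemma (in pair_graph) finite_sign_repartitions: "finite (sign_repartitions G)"
proof -
  have "(UNIV :: sign set) = {Positive, Negative}" using sign.exhaust by auto
  then have "finite (UNIV :: sign set)" by (metis finite.emptyI finite.insertI)
  then show ?thesis
    unfolding sign_repartitions_def by (intro finite_PiE pair_finite_arcs)
qed

lemma sign_repartitions_nonempty: "sign_repartitions G \<noteq> {}"
  by (simp add: sign_repartitions_def PiE_eq_empty_iff)

lemma (in pair_graph) finite_configurations: "finite (configurations G)"
  unfolding configurations_def by (intro finite_PiE pair_finite_verts) simp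

lemma (in pair_graph) finite_maximal_independent_sets: "finite {S. maximal_independent_set G S}"
  by (rule finite_subset[of _ "Pow (pverts G)"])
     (auto simp: maximal_independent_set_def independent_set_def pair_finite_verts)

lemma (in pair_graph) finite_C4_matchings: "finite {M. C4_matching G M}"
proof -
  have "edges G = (\<lambda>(u, v). {u, v}) ` parcs G" by (auto simp: edges_def)
  then have "finite (edges G)" by (simp add: pair_finite_arcs)
  then show ?thesis
    by (rule finite_subset[rotated, OF finite_Pow_iff[THEN iffD2]])
       (auto simp: C4_matching_def matching_def)
qed

lemma C4_matching_empty: "C4_matching G {}"
  by (simp add: C4_matching_def matching_def)

lemma (in pair_graph) conjunctive_network_configuration:
  assumes "x \<in> configurations G"
  shows "conjunctive_network G \<sigma> x \<in> configurations G"
proof -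
  have x: "x u \<in> {0, 1}" if "u \<in> pverts G" for u
    using assms that by (auto simp: configurations_def)
  have prod01: "prod g A \<in> {0, 1}" if "\<And>u. u \<in> A \<Longrightarrow> g u \<in> {0, 1 :: int}" for g and A :: "'a set"
    using that
  proof (induction A rule: infinite_finite_induct)
    case (insert a A)
    then have "g a \<in> {0, 1}" "prod g A \<in> {0, 1}" by blast+
    then show ?case using insert.hyps by auto
  qed auto
  have "conjunctive_network G \<sigma> x v \<in> {0, 1}" if v: "v \<in> pverts G" for v
  proof -
    have "(\<Prod>u\<in>{u. (u, v) \<in> parcs G \<and> \<sigma> (u, v) = Positive}. x u) \<in> {0, 1}"
      by (rule prod01) (use x in_arcsD1 in blast)
    moreover have "(\<Prod>u\<in>{u. (u, v) \<in> parcs G \<and> \<sigma> (u, v) = Negative}. 1 - x u) \<in> {0, 1}"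
    proof (rule prod01)
      fix u assume "u \<in> {u. (u, v) \<in> parcs G \<and> \<sigma> (u, v) = Negative}"
      then have "u \<in> pverts G" by (auto dest: in_arcsD1)
      then show "1 - x u \<in> {0, 1}" using x[of u] by auto
    qed
    ultimately show ?thesis using v by (auto simp: conjunctive_network_def)
  qed
  then show ?thesis
    unfolding configurations_def by (intro PiE_I) (auto simp: conjunctive_network_def)
qed

lemma C4_arcs:
  "parcs C4 = {(0, 1), (1, 0), (1, 2), (2, 1), (2, 3), (3, 2), (3, 0), (0, 3)}" (is "_ = ?A")
proof (rule set_eqI, clarify, rule iffI)
  fix i j
  assume "(i, j) \<in> parcs C4"
  then have ij: "i < 4" "j < 4" "j = (i + 1) mod 4 \<or> i = (j + 1) mod 4"
    by (simp_all add: C4_def)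
  have "i = 0 \<or> i = 1 \<or> i = 2 \<or> i = 3" "j = 0 \<or> j = 1 \<or> j = 2 \<or> j = 3"
    using ij(1,2) by linarith+
  then show "(i, j) \<in> ?A"
    using ij(3) by (elim disjE; simp)
next
  fix i j
  assume "(i, j) \<in> ?A"
  then show "(i, j) \<in> parcs C4"
    unfolding C4_def by (elim insertE; simp)
qed

lemma C4_verts: "pverts C4 = {0, 1, 2, 3}"
  by (auto simp: C4_def)

lemma (in pair_graph) induced_C4_iff:
  "induced_C4 H G \<longleftrightarrow> (\<exists>a b c d. distinct [a, b, c, d] \<and> pverts H = {a, b, c, d} \<and>
     parcs H = parcs G \<inter> {a, b, c, d} \<times> {a, b, c, d} \<and>
     {(a, b), (b, c), (c, d), (d, a)} \<subseteq> parcs G \<and> (a, c) \<notin> parcs G \<and> (b, d) \<notin> parcs G)"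
    (is "?L \<longleftrightarrow> ?R")
proof
  assume ?L
  then obtain f where sub: "induced_subgraph (with_proj H) (with_proj G)"
    and iso: "pre_digraph.digraph_isomorphism (with_proj C4) f"
    and H: "with_proj H = app_iso f (with_proj C4)"
    unfolding induced_C4_def digraph_iso_def by blast
  define h where "h = iso_verts f"
  interpret C: pair_wf_digraph C4 by unfold_locales (auto simp: C4_def)
  define a b c d where abcd: "a = h 0" "b = h 1" "c = h 2" "d = h 3"
  have vH: "pverts H = {a, b, c, d}"
    using arg_cong[OF H, of verts] by (simp add: C4_verts abcd h_def)
  have "parcs H = (\<lambda>(u, v). (h u, h v)) ` parcs C4"
    using arg_cong[OF H, of arcs_ends] C.arcs_ends_app_iso_eq[OF iso] by (simp add: h_def)
  then have aH: "parcs H = {(a, b), (b, a), (b, c), (c, b), (c, d), (d, c), (d, a), (a, d)}"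
    by (simp only: C4_arcs image_insert image_empty prod.case abcd)
  have "inj_on h {0, 1, 2, 3}"
    using iso by (simp only: C.digraph_isomorphism_def C4_verts h_def)
  then have d: "distinct [a, b, c, d]"
    by (simp add: inj_on_def abcd)
  have restr: "{e \<in> A. fst e \<in> W \<and> snd e \<in> W} = A \<inter> W \<times> W" for A and W :: "'a set"
    by auto
  have ind: "parcs H = parcs G \<inter> {a, b, c, d} \<times> {a, b, c, d}"
    using sub by (simp only: induced_subgraph_def with_proj_simps restr vH)
  have "a \<noteq> b" "c \<noteq> b" "c \<noteq> d" "d \<noteq> c" "d \<noteq> a" "b \<noteq> a"
    using d unfolding distinct.simps list.set by blast+
  then have "(a, c) \<notin> parcs H" "(b, d) \<notin> parcs H"
    unfolding aH by simp_all
  then have "(a, c) \<notin> parcs G" "(b, d) \<notin> parcs G"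
    unfolding ind by simp_all
  moreover have "{(a, b), (b, c), (c, d), (d, a)} \<subseteq> parcs H"
    unfolding aH by simp
  then have "{(a, b), (b, c), (c, d), (d, a)} \<subseteq> parcs G"
    unfolding ind by (rule subset_trans) (rule Int_lower1)
  ultimately show ?R
    using d vH ind by (intro exI conjI)
next
  assume ?R
  then obtain a b c d where d: "distinct [a, b, c, d]" and vH: "pverts H = {a, b, c, d}"
    and ind: "parcs H = parcs G \<inter> {a, b, c, d} \<times> {a, b, c, d}"
    and arcs: "{(a, b), (b, c), (c, d), (d, a)} \<subseteq> parcs G"
    and non: "(a, c) \<notin> parcs G" "(b, d) \<notin> parcs G"
    by (elim exE conjE) (rule that)
  have sym: "(v, u) \<in> parcs G" if "(u, v) \<in> parcs G" for u v
    using that sym_arcs by (auto simp: symmetric_def dest: symD)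
  have loop: "(v, v) \<notin> parcs G" for v
    using pair_no_loops by fastforce
  have aH: "parcs H = {(a, b), (b, a), (b, c), (c, b), (c, d), (d, c), (d, a), (a, d)}"
  proof -
    have e: "(a, b) \<in> parcs G" "(b, c) \<in> parcs G" "(c, d) \<in> parcs G" "(d, a) \<in> parcs G"
      using arcs by simp_all
    have "(c, a) \<notin> parcs G" "(d, b) \<notin> parcs G"
      using non sym by blast+
    then show ?thesis
      unfolding ind using non loop e e[THEN sym] by auto
  qed
  have inV: "{a, b, c, d} \<subseteq> pverts G"
    using arcs in_arcsD1 by blast
  interpret H: pair_wf_digraph H by unfold_locales (auto simp: aH vH)
  interpret C: pair_wf_digraph C4 by unfold_locales (auto simp: C4_def)
  have restr: "{e \<in> A. fst e \<in> W \<and> snd e \<in> W} = A \<inter> W \<times> W" for A and W :: "'a set"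
    by auto
  have "induced_subgraph (with_proj H) (with_proj G)"
    unfolding induced_subgraph_def subgraph_def compatible_def with_proj_simps restr vH
    using inV H.wf_digraph wf_digraph by (simp only: ind Int_lower1 simp_thms)
  moreover
  define h where "h i = [a, b, c, d] ! i" for i
  have h: "h 0 = a" "h 1 = b" "h 2 = c" "h 3 = d"
    by (simp_all add: h_def eval_nat_numeral)
  define f where "f = \<lparr> iso_verts = h, iso_arcs = map_prod h h, iso_head = snd, iso_tail = fst \<rparr>"
  have inj: "inj_on h {0, 1, 2, 3}"
  proof -
    have ne: "a \<noteq> b" "a \<noteq> c" "a \<noteq> d" "b \<noteq> c" "b \<noteq> d" "c \<noteq> d"
      using d by simp_all
    show ?thesis
      unfolding inj_on_def by (simp add: h[simplified] ne ne[THEN not_sym])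
  qed
  have "C.digraph_isomorphism f"
    unfolding C.digraph_isomorphism_def
  proof (intro conjI)
    show "wf_digraph (with_proj C4)" by (rule C.wf_digraph)
    show "inj_on (iso_verts f) (pverts C4)" using inj by (simp add: f_def C4_verts)
    have "parcs C4 \<subseteq> {0, 1, 2, 3} \<times> {0, 1, 2, 3}" by (auto simp: C4_arcs)
    then show "inj_on (iso_arcs f) (parcs C4)"
      using inj_on_subset[OF map_prod_inj_on[OF inj inj]] by (simp add: f_def)
  qed (auto simp: f_def)
  moreover have "with_proj H = app_iso f (with_proj C4)"
    by (simp add: app_iso_def f_def with_proj_def C4_verts C4_arcs vH aH h h[simplified])
  ultimately show ?L
    unfolding induced_C4_def digraph_iso_def by blast
qed

end

theory Submission
  imports Defs
begin

text \<open>
  Call two vertices equivalent if they take the same value in every fixed point of \<open>G\<^sub>\<sigma>\<close>, and let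
  \<open>A\<close> be the set of vertices that are not constantly 0. Two adjacent vertices of a fixed point
  (seen as a set) are equivalent, and a vertex of \<open>A\<close> outside a fixed point has a neighbour in it or
  an equivalent neighbour. For families \<open>F A\<close> of sets with these properties and an
  equivalence class \<open>C\<close> one has \<open>|F A| \<le> |F (A - C)| + |F (A - N[C])|\<close>. If \<open>ab\<close> is an edge inside
  \<open>C\<close>, then \<open>mis (A - a - b) + mis (A - N[a] - N[b])\<close> is at most \<open>3/2 \<cdot> mis A\<close>, and at most
  \<open>mis A\<close> if \<open>ab\<close> is in no induced 4-cycle of \<open>A\<close>. Eliminating the classes one by one costs a factor
  \<open>3/2\<close> for each class in a set \<open>B\<close> such that deleting \<open>B\<close> leaves no induced 4-cycle with an edge
  inside a class. A suitable choice of \<open>B\<close> allows picking one edge from each class of \<open>B\<close> so that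
  these edges form a matching as in the definition of \<open>m(G)\<close>.
\<close>

section \<open>Maximal independent sets of induced subgraphs\<close>

text \<open>Maximality is encoded as domination of \<open>A - S\<close>. The arcs stay fixed and
  only \<open>A\<close> shrinks, so that vertices are deleted without forming new graphs.\<close>

definition MI :: "('a \<times> 'a) set \<Rightarrow> 'a set \<Rightarrow> 'a set set" where
  "MI E A = {S. S \<subseteq> A \<and> (\<forall>u\<in>S. \<forall>v\<in>S. (u, v) \<notin> E) \<and> (\<forall>v\<in>A - S. \<exists>u\<in>S. (u, v) \<in> E)}"

text \<open>The cyclic order is \<open>a\<close>, \<open>b\<close>, \<open>y\<close>,
  \<open>z\<close>, so \<open>ab\<close> and \<open>yz\<close> are opposite edges. Distinctness of
  adjacent vertices is left to irreflexivity of \<open>E\<close>.\<close>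

definition induced_4_cycle :: "('a \<times> 'a) set \<Rightarrow> 'a \<Rightarrow> 'a \<Rightarrow> 'a \<Rightarrow> 'a \<Rightarrow> bool" where
  "induced_4_cycle E a b y z \<longleftrightarrow> (a, b) \<in> E \<and> (b, y) \<in> E \<and> (y, z) \<in> E \<and> (z, a) \<in> E \<and>
     (a, y) \<notin> E \<and> (b, z) \<notin> E \<and> a \<noteq> y \<and> b \<noteq> z"

definition closed_neighbourhood :: "('a \<times> 'a) set \<Rightarrow> 'a \<Rightarrow> 'a set" where
  "closed_neighbourhood E a = insert a (E `` {a})"

lemma finite_MI: "finite A \<Longrightarrow> finite (MI E A)"
  by (rule finite_subset[of _ "Pow A"]) (auto simp: MI_def)

section \<open>Extension of independent sets and deletion of an edge\<close>

locale loopless_symmetric =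
  fixes E :: "('a \<times> 'a) set"
  assumes symE: "sym E" and irreflE: "irrefl E"
begin

lemma E_sym: "(u, v) \<in> E \<Longrightarrow> (v, u) \<in> E"
  using symE by (rule symD)

lemma E_irrefl: "(v, v) \<notin> E"
  using irreflE by (auto simp: irrefl_def)

lemma induced_4_cycle_opposite: "induced_4_cycle E a b y z \<Longrightarrow> induced_4_cycle E y z a b"
  by (auto simp: induced_4_cycle_def dest: E_sym)

lemma MI_extend:
  assumes "finite A" "I \<subseteq> A" "\<And>u v. u \<in> I \<Longrightarrow> v \<in> I \<Longrightarrow> (u, v) \<notin> E"
  obtains T where "T \<in> MI E A" "I \<subseteq> T"
proof -
  let ?F = "{T. T \<subseteq> A \<and> (\<forall>u\<in>T. \<forall>v\<in>T. (u, v) \<notin> E)}"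
  have "finite ?F" by (rule finite_subset[of _ "Pow A"]) (use assms(1) in auto)
  moreover have "I \<in> ?F" using assms by auto
  ultimately obtain T where T: "T \<in> ?F" "I \<subseteq> T" "\<And>T'. T' \<in> ?F \<Longrightarrow> T \<subseteq> T' \<Longrightarrow> T = T'"
    using finite_has_maximal2[of ?F I] by auto
  have "\<exists>u\<in>T. (u, v) \<in> E" if v: "v \<in> A - T" for v
  proof (rule ccontr)
    assume "\<not> ?thesis"
    then have "insert v T \<in> ?F" using T(1) v E_irrefl E_sym by blast
    with T(3)[of "insert v T"] v show False by auto
  qed
  with T(1,2) show thesis by (intro that[of T]) (auto simp: MI_def)
qed

text \<open>\<open>R\<close> already dominates \<open>D - R\<close>, so an independent superset of
  \<open>R\<close> gains no vertex of \<open>D\<close>. This makes the trace maps below cover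
  \<open>MI E D\<close>.\<close>

lemma MI_extend_inter:
  assumes "finite A" "D \<subseteq> A" "R \<in> MI E D" "I \<subseteq> A"
    and "\<And>u v. u \<in> R \<union> I \<Longrightarrow> v \<in> R \<union> I \<Longrightarrow> (u, v) \<notin> E"
  obtains T where "T \<in> MI E A" "R \<union> I \<subseteq> T" "T \<inter> D = R"
proof -
  have R: "R \<subseteq> D" "\<And>v. v \<in> D \<Longrightarrow> v \<notin> R \<Longrightarrow> \<exists>u\<in>R. (u, v) \<in> E"
    using assms(3) by (auto simp: MI_def)
  obtain T where T: "T \<in> MI E A" "R \<union> I \<subseteq> T"
    using MI_extend[of A "R \<union> I"] assms(1,2,4,5) R(1) by (metis Un_subset_iff order_trans)
  have "T \<inter> D \<subseteq> R"
    using T R(2) unfolding MI_def by blast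
  with T R(1) show thesis by (intro that[of T]) auto
qed

lemma card_MI_mono:
  assumes "finite A" "D \<subseteq> A"
  shows "card (MI E D) \<le> card (MI E A)"
proof (rule surj_card_le)
  show "finite (MI E A)" using assms(1) by (rule finite_MI)
  show "MI E D \<subseteq> (\<lambda>T. T \<inter> D) ` MI E A"
  proof
    fix R assume R: "R \<in> MI E D"
    have "(u, v) \<notin> E" if "u \<in> R \<union> {}" "v \<in> R \<union> {}" for u v
      using R that by (auto simp: MI_def)
    then obtain T where "T \<in> MI E A" "T \<inter> D = R"
      using MI_extend_inter[OF assms R empty_subsetI] by metis
    then show "R \<in> (\<lambda>T. T \<inter> D) ` MI E A" by blast
  qed
qed

lemma MI_extend_vertex:
  assumes "finite A" "D \<subseteq> A" "D \<inter> closed_neighbourhood E a = {}" "a \<in> A" "R \<in> MI E D"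
  obtains T where "T \<in> MI E A" "a \<in> T" "T \<inter> D = R"
proof -
  have "(u, v) \<notin> E" if "u \<in> R \<union> {a}" "v \<in> R \<union> {a}" for u v
    using that assms(3,5) E_sym E_irrefl by (auto simp: MI_def closed_neighbourhood_def)
  then obtain T where "T \<in> MI E A" "R \<union> {a} \<subseteq> T" "T \<inter> D = R"
    using MI_extend_inter[OF assms(1,2,5), of "{a}"] assms(4) by (metis empty_subsetI insert_subset)
  then show thesis by (intro that) auto
qed

text \<open>No independent set contains both \<open>a\<close> and \<open>b\<close>, and the sets
  through either vertex alone already have all of \<open>MI E D\<close> as traces.\<close>

lemma card_MI_edge_half:
  assumes "finite A" "D \<subseteq> A" "a \<in> A" "b \<in> A" "(a, b) \<in> E"
    and "D \<inter> closed_neighbourhood E a = {}" "D \<inter> closed_neighbourhood E b = {}"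
  shows "2 * card (MI E D) \<le> card (MI E A)"
proof -
  have half: "card (MI E D) \<le> card {T \<in> MI E A. v \<in> T}"
    if v: "v \<in> A" "D \<inter> closed_neighbourhood E v = {}" for v
  proof (rule surj_card_le)
    show "finite {T \<in> MI E A. v \<in> T}" using finite_MI[OF assms(1)] by simp
    show "MI E D \<subseteq> (\<lambda>T. T \<inter> D) ` {T \<in> MI E A. v \<in> T}"
    proof
      fix R assume "R \<in> MI E D"
      then obtain T where "T \<in> MI E A" "v \<in> T" "T \<inter> D = R"
        by (rule MI_extend_vertex[OF assms(1,2) v(2,1)])
      then show "R \<in> (\<lambda>T. T \<inter> D) ` {T \<in> MI E A. v \<in> T}" by blast
    qed
  qed
  have "card {T \<in> MI E A. a \<in> T} + card {T \<in> MI E A. b \<in> T}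
      = card ({T \<in> MI E A. a \<in> T} \<union> {T \<in> MI E A. b \<in> T})"
  proof (rule card_Un_disjoint[symmetric])
    show "{T \<in> MI E A. a \<in> T} \<inter> {T \<in> MI E A. b \<in> T} = {}"
      using assms(5) by (auto simp: MI_def)
  qed (use finite_MI[OF assms(1)] in auto)
  also have "\<dots> \<le> card (MI E A)"
    by (rule card_mono) (use finite_MI[OF assms(1)] in auto)
  finally show ?thesis
    using half[of a] half[of b] assms by linarith
qed

text \<open>
  Extending \<open>X \<in> MI E (A - {a, b})\<close> by \<open>a\<close> if possible, else by \<open>b\<close> if possible, is injective. Each
  \<open>R \<in> MI E D\<close> is the trace on \<open>D\<close> of a maximal independent set outside the image: one containing
  \<open>a\<close> if \<open>R\<close> fails to dominate a neighbour of \<open>a\<close> that is not adjacent to \<open>b\<close>, and one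
  containing \<open>b\<close> otherwise.
\<close>

lemma card_MI_edge:
  assumes fin: "finite A" and a: "a \<in> A" and b: "b \<in> A" and ab: "(a, b) \<in> E"
    and C4: "\<And>y z. y \<in> A \<Longrightarrow> z \<in> A \<Longrightarrow> \<not> induced_4_cycle E a b y z"
  defines "D \<equiv> A - closed_neighbourhood E a - closed_neighbourhood E b"
  shows "card (MI E (A - {a, b})) + card (MI E D) \<le> card (MI E A)"
proof -
  let ?A' = "A - {a, b}"
  define f where "f X = (if \<forall>x\<in>X. (x, a) \<notin> E then insert a X
    else if \<forall>x\<in>X. (x, b) \<notin> E then insert b X else X)" for X
  have f_minus: "f X - {a, b} = X" if "X \<in> MI E ?A'" for X
    using that by (auto simp: f_def MI_def)
  have f_MI: "f X \<in> MI E A" if "X \<in> MI E ?A'" for X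
  proof -
    have X: "X \<subseteq> ?A'" "\<forall>u\<in>X. \<forall>v\<in>X. (u, v) \<notin> E" "\<forall>v\<in>?A' - X. \<exists>u\<in>X. (u, v) \<in> E"
      using that by (auto simp: MI_def)
    consider "\<forall>x\<in>X. (x, a) \<notin> E"
      | "\<not> (\<forall>x\<in>X. (x, a) \<notin> E)" "\<forall>x\<in>X. (x, b) \<notin> E"
      | "\<not> (\<forall>x\<in>X. (x, a) \<notin> E)" "\<not> (\<forall>x\<in>X. (x, b) \<notin> E)" by blast
    then show ?thesis
    proof cases
      case 1
      then have "f X = insert a X" by (auto simp: f_def)
      then show ?thesis using 1 X a ab E_sym E_irrefl unfolding MI_def by auto
    next
      case 2
      then have "f X = insert b X" by (auto simp: f_def)
      then show ?thesis using 2 X b ab E_sym E_irrefl unfolding MI_def by auto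
    next
      case 3
      then have "f X = X" by (auto simp: f_def)
      then show ?thesis using 3 X unfolding MI_def by auto
    qed
  qed
  have inj: "inj_on f (MI E ?A')"
    by (rule inj_on_inverseI[of _ "\<lambda>T. T - {a, b}"]) (rule f_minus)
  have D: "D \<subseteq> A" "D \<inter> closed_neighbourhood E a = {}" "D \<inter> closed_neighbourhood E b = {}"
    by (auto simp: D_def)
  have "card (MI E D) \<le> card (MI E A - f ` MI E ?A')"
  proof (rule surj_card_le)
    show "finite (MI E A - f ` MI E ?A')" using finite_MI[OF fin] by simp
    show "MI E D \<subseteq> (\<lambda>T. T \<inter> D) ` (MI E A - f ` MI E ?A')"
    proof
      fix R assume R: "R \<in> MI E D"
      define Z where "Z = {z \<in> A. (z, a) \<in> E \<and> (z, b) \<notin> E \<and> z \<noteq> b \<and> (\<forall>r\<in>R. (r, z) \<notin> E)}"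
      have "\<exists>T\<in>MI E A - f ` MI E ?A'. T \<inter> D = R"
      proof (cases "Z = {}")
        case False
        then obtain z where z: "z \<in> A" "(z, a) \<in> E" "(z, b) \<notin> E" "z \<noteq> b" "\<forall>r\<in>R. (r, z) \<notin> E"
          by (auto simp: Z_def)
        obtain T where T: "T \<in> MI E A" "a \<in> T" "T \<inter> D = R"
          using MI_extend_vertex[OF fin D(1,2) a R] .
        have indT: "\<And>u v. u \<in> T \<Longrightarrow> v \<in> T \<Longrightarrow> (u, v) \<notin> E" and TA: "T \<subseteq> A"
          using T(1) by (auto simp: MI_def)
        have "T \<notin> f ` MI E ?A'"
        proof
          assume "T \<in> f ` MI E ?A'"
          then obtain X where X: "X \<in> MI E ?A'" "T = f X" by blast
          have XT: "X = T - {a, b}" using f_minus X by simp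
          have "z \<notin> T" using indT z(2) T(2) by blast
          then have "z \<in> ?A' - X" using z E_irrefl XT by auto
          \<comment> \<open>The vertex \<open>x\<close> dominating \<open>z\<close> is not in
            \<open>R\<close>, hence not in \<open>D\<close>. It is not adjacent to \<open>a\<close>,
            since both lie in \<open>T\<close>; so it is adjacent to \<open>b\<close>, which closes
            an induced 4-cycle.\<close>
          then have "\<exists>x\<in>X. (x, z) \<in> E" using X(1) unfolding MI_def by blast
          then obtain x where x: "x \<in> X" "(x, z) \<in> E" by blast
          then have xT: "x \<in> T" "x \<noteq> a" "x \<noteq> b" "x \<in> A" using XT TA by auto
          have xa: "(a, x) \<notin> E" using indT T(2) xT by blast
          have "x \<notin> R" using x z by auto
          then have "x \<notin> D" using T(3) xT by auto
          then have "(b, x) \<in> E" using xT xa by (auto simp: D_def closed_neighbourhood_def)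
          then have "induced_4_cycle E a b x z"
            using ab x z xa xT E_sym by (auto simp: induced_4_cycle_def)
          then show False using C4 xT z by blast
        qed
        then show ?thesis using T by blast
      next
        case True
        obtain T where T: "T \<in> MI E A" "b \<in> T" "T \<inter> D = R"
          using MI_extend_vertex[OF fin D(1,3) b R] .
        have indT: "\<And>u v. u \<in> T \<Longrightarrow> v \<in> T \<Longrightarrow> (u, v) \<notin> E" and TA: "T \<subseteq> A"
          using T(1) by (auto simp: MI_def)
        have "T \<notin> f ` MI E ?A'"
        proof
          assume "T \<in> f ` MI E ?A'"
          then obtain X where X: "X \<in> MI E ?A'" "T = f X" by blast
          have XT: "X = T - {a, b}" using f_minus X by simp
          have "a \<notin> T" using indT ab T(2) by blast
          \<comment> \<open>\<open>X\<close> was not extended by \<open>a\<close>, so it contains a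
            neighbour of \<open>a\<close>. Independence of \<open>T\<close>, which contains
            \<open>b\<close> and \<open>R\<close>, puts this neighbour into
            \<open>Z\<close>.\<close>
          then obtain x where x: "x \<in> X" "(x, a) \<in> E" using X(2) by (auto simp: f_def split: if_splits)
          then have xT: "x \<in> T" "x \<noteq> b" using XT by auto
          then have "x \<in> Z" using x TA indT T(2,3) by (auto simp: Z_def)
          then show False using True by simp
        qed
        then show ?thesis using T by blast
      qed
      then show "R \<in> (\<lambda>T. T \<inter> D) ` (MI E A - f ` MI E ?A')" by blast
    qed
  qed
  also have "\<dots> = card (MI E A) - card (MI E ?A')"
    using f_MI card_image[OF inj] finite_MI[OF fin]
    by (subst card_Diff_subset) (auto intro: finite_subset)
  \<comment> \<open>Subtraction of naturals truncates; this makes the difference above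
    exact.\<close>
  moreover have "card (MI E ?A') \<le> card (MI E A)"
    by (rule card_MI_mono[OF fin]) auto
  ultimately show ?thesis by linarith
qed

end

section \<open>Sets compatible with a colouring\<close>

text \<open>
  The colour classes play the role of contracted vertices, except that a class containing an edge
  need not be dominated.
\<close>

definition compatible_sets :: "('a \<times> 'a) set \<Rightarrow> ('a \<Rightarrow> 'b) \<Rightarrow> 'a set \<Rightarrow> 'a set set" where
  "compatible_sets E c A = {S. S \<subseteq> A \<and>
     (\<forall>u\<in>S. \<forall>v\<in>A. c u = c v \<longrightarrow> v \<in> S) \<and>
     (\<forall>u\<in>S. \<forall>v\<in>S. (u, v) \<in> E \<longrightarrow> c u = c v) \<and>
     (\<forall>v\<in>A - S. (\<exists>u\<in>S. (u, v) \<in> E) \<or> (\<exists>u\<in>A. (u, v) \<in> E \<and> c u = c v))}"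

text \<open>This is the closed neighbourhood of \<open>k\<close> in the quotient of \<open>A\<close>
  by colours. Whole classes are taken, so the remainder is again a union of classes.\<close>

definition colour_neighbourhood :: "('a \<times> 'a) set \<Rightarrow> ('a \<Rightarrow> 'b) \<Rightarrow> 'a set \<Rightarrow> 'b \<Rightarrow> 'a set" where
  "colour_neighbourhood E c A k =
     {v \<in> A. c v = k \<or> (\<exists>u\<in>A. \<exists>w\<in>A. c u = c v \<and> c w = k \<and> (u, w) \<in> E)}"

lemma finite_compatible_sets: "finite A \<Longrightarrow> finite (compatible_sets E c A)"
  by (rule finite_subset[of _ "Pow A"]) (auto simp: compatible_sets_def)

section \<open>Elimination of colour classes one at a time\<close>

context loopless_symmetric
begin

text \<open>A compatible set misses class \<open>k\<close> or contains all of it. In the latter case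
  it avoids every other class adjacent to class \<open>k\<close>, so its part outside the
  neighbourhood determines it.\<close>

lemma card_compatible_sets_split:
  assumes fin: "finite A"
  shows "card (compatible_sets E c A) \<le> card (compatible_sets E c (A - {v. c v = k})) +
    card (compatible_sets E c (A - colour_neighbourhood E c A k))"
proof -
  let ?C = "{v \<in> A. c v = k}" and ?N = "colour_neighbourhood E c A k"
  let ?F = "compatible_sets E c"
  have "?F A \<subseteq> ?F (A - {v. c v = k}) \<union> (\<lambda>S. S \<union> ?C) ` ?F (A - ?N)"
  proof
    fix S assume S: "S \<in> ?F A"
    have S1: "S \<subseteq> A" "\<And>u v. u \<in> S \<Longrightarrow> v \<in> A \<Longrightarrow> c u = c v \<Longrightarrow> v \<in> S"
      "\<And>u v. u \<in> S \<Longrightarrow> v \<in> S \<Longrightarrow> (u, v) \<in> E \<Longrightarrow> c u = c v"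
      "\<And>v. v \<in> A \<Longrightarrow> v \<notin> S \<Longrightarrow> (\<exists>u\<in>S. (u, v) \<in> E) \<or> (\<exists>u\<in>A. (u, v) \<in> E \<and> c u = c v)"
      using S unfolding compatible_sets_def by blast+
    show "S \<in> ?F (A - {v. c v = k}) \<union> (\<lambda>S. S \<union> ?C) ` ?F (A - ?N)"
    proof (cases "S \<inter> ?C = {}")
      case True
      have "S \<in> ?F (A - {v. c v = k})"
        unfolding compatible_sets_def
      proof (intro CollectI conjI ballI impI)
        show "S \<subseteq> A - {v. c v = k}" using True S1(1) by auto
        fix v assume v: "v \<in> A - {v. c v = k} - S"
        then show "(\<exists>u\<in>S. (u, v) \<in> E) \<or> (\<exists>u\<in>A - {v. c v = k}. (u, v) \<in> E \<and> c u = c v)"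
          using S1(4)[of v] by auto
      next
        fix u v assume "u \<in> S" "v \<in> A - {v. c v = k}" "c u = c v"
        then show "v \<in> S" using S1(2) by blast
      next
        fix u v assume "u \<in> S" "v \<in> S" "(u, v) \<in> E"
        then show "c u = c v" using S1(3) by blast
      qed
      then show ?thesis by blast
    next
      case False
      then have CS: "?C \<subseteq> S" using S1(2) by blast
      have inN: "v \<in> ?N" if "v \<in> A" "u \<in> S" "c u = k" "(u, v) \<in> E" for u v
        using that S1(1) E_sym unfolding colour_neighbourhood_def by blast
      have sub: "S - ?C \<subseteq> A - ?N"
      proof
        fix v assume v: "v \<in> S - ?C"
        have "v \<notin> ?N"
        proof
          assume "v \<in> ?N"
          then obtain u w where uw: "u \<in> A" "w \<in> A" "c u = c v" "c w = k" "(u, w) \<in> E"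
            using v S1(1) by (auto simp: colour_neighbourhood_def)
          then have "u \<in> S" "w \<in> S" using S1(2)[of v u] v CS by auto
          then have "c u = c w" using S1(3) uw by blast
          then show False using uw v S1(1) by auto
        qed
        then show "v \<in> A - ?N" using v S1(1) by auto
      qed
      \<comment> \<open>Domination survives: a vertex outside the neighbourhood has no neighbour in
        class \<open>k\<close>, by \<open>inN\<close>, and its same-coloured neighbours stay because
        whole classes are removed.\<close>
      have same: "u \<notin> ?N" if "v \<in> A - ?N" "u \<in> A" "c u = c v" for u v
        using that unfolding colour_neighbourhood_def by auto
      have "S - ?C \<in> ?F (A - ?N)"
        unfolding compatible_sets_def
      proof (intro CollectI conjI ballI impI)
        fix v assume v: "v \<in> A - ?N - (S - ?C)"
        then have "v \<in> A" "v \<notin> S" by (auto simp: colour_neighbourhood_def)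
        from S1(4)[OF this]
        show "(\<exists>u\<in>S - ?C. (u, v) \<in> E) \<or> (\<exists>u\<in>A - ?N. (u, v) \<in> E \<and> c u = c v)"
          using v inN same S1(1) by blast
      next
        fix u v assume "u \<in> S - ?C" "v \<in> A - ?N" "c u = c v"
        then show "v \<in> S - ?C" using S1(1,2) by auto
      next
        fix u v assume "u \<in> S - ?C" "v \<in> S - ?C" "(u, v) \<in> E"
        then show "c u = c v" using S1(3) by blast
      qed (rule sub)
      moreover have "S = S - ?C \<union> ?C" using CS by blast
      ultimately show ?thesis by blast
    qed
  qed
  then have "card (?F A) \<le> card (?F (A - {v. c v = k}) \<union> (\<lambda>S. S \<union> ?C) ` ?F (A - ?N))"
    by (rule card_mono[rotated]) (use fin finite_compatible_sets in blast)
  also have "\<dots> \<le> card (?F (A - {v. c v = k})) + card (?F (A - ?N))"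
    by (rule order_trans[OF card_Un_le])
       (use fin in \<open>auto intro!: card_image_le finite_compatible_sets\<close>)
  finally show ?thesis .
qed

text \<open>For an edge \<open>ab\<close> inside class \<open>k\<close> this puts the remainder into
  the set \<open>D\<close> of the edge bounds.\<close>

lemma colour_neighbourhood_avoids:
  assumes "a \<in> A" "c a = k"
  shows "(A - colour_neighbourhood E c A k) \<inter> closed_neighbourhood E a = {}"
proof -
  have "v \<in> colour_neighbourhood E c A k" if "v \<in> A" "(a, v) \<in> E" for v
    using that assms E_sym[OF that(2)] unfolding colour_neighbourhood_def by blast
  then show ?thesis
    using assms by (auto simp: closed_neighbourhood_def colour_neighbourhood_def)
qed

text \<open>Without an edge inside a class, compatible sets are maximal independent sets. Otherwise
  the class of such an edge is split off, and \<open>card_MI_edge\<close> bounds the two remainders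
  together.\<close>

lemma card_compatible_sets_le_MI:
  assumes "finite A"
    and "\<And>a b y z. {a, b, y, z} \<subseteq> A \<Longrightarrow> c a = c b \<Longrightarrow> \<not> induced_4_cycle E a b y z"
  shows "card (compatible_sets E c A) \<le> card (MI E A)"
  using assms
proof (induction "card A" arbitrary: A rule: less_induct)
  case less
  let ?F = "compatible_sets E c"
  show ?case
  proof (cases "\<exists>a\<in>A. \<exists>b\<in>A. (a, b) \<in> E \<and> c a = c b")
    case False
    then have "?F A \<subseteq> MI E A" unfolding compatible_sets_def MI_def by blast
    then show ?thesis using finite_MI[OF less.prems(1)] by (rule card_mono[rotated])
  next
    case True
    then obtain a b where ab: "a \<in> A" "b \<in> A" "(a, b) \<in> E" "c a = c b" by blast
    let ?A1 = "A - {v. c v = c a}" and ?A2 = "A - colour_neighbourhood E c A (c a)"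
    have IH: "card (?F X) \<le> card (MI E X)" if "X \<subseteq> A" "a \<notin> X" for X
    proof (rule less.hyps)
      show "card X < card A" using that ab less.prems(1) by (intro psubset_card_mono) auto
      show "finite X" using that less.prems(1) finite_subset by blast
      show "\<not> induced_4_cycle E a b y z" if "{a, b, y, z} \<subseteq> X" "c a = c b" for a b y z
        by (rule less.prems(2)) (use that \<open>X \<subseteq> A\<close> in auto)
    qed
    have "card (?F A) \<le> card (?F ?A1) + card (?F ?A2)"
      by (rule card_compatible_sets_split[OF less.prems(1)])
    also have "\<dots> \<le> card (MI E ?A1) + card (MI E ?A2)"
      by (intro add_mono IH) (use ab in \<open>auto simp: colour_neighbourhood_def\<close>)
    also have "\<dots> \<le> card (MI E (A - {a, b})) +
        card (MI E (A - closed_neighbourhood E a - closed_neighbourhood E b))"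
    proof (intro add_mono card_MI_mono)
      show "?A2 \<subseteq> A - closed_neighbourhood E a - closed_neighbourhood E b"
        using colour_neighbourhood_avoids[of a A c "c a"] colour_neighbourhood_avoids[of b A c "c a"] ab
        by auto
    qed (use less.prems(1) ab in auto)
    also have "\<dots> \<le> card (MI E A)"
      by (rule card_MI_edge) (use less.prems ab in auto)
    finally show ?thesis .
  qed
qed

text \<open>Each class of \<open>B\<close> contains an edge, so splitting it off costs 1 + 1/2: one
  remainder is bounded by monotonicity, the other by \<open>card_MI_edge_half\<close>.\<close>

lemma card_compatible_sets_le:
  assumes "finite B" "finite A"
    and "\<And>v. v \<in> A \<Longrightarrow> c v \<in> B \<Longrightarrow> \<exists>a\<in>A. \<exists>b\<in>A. (a, b) \<in> E \<and> c a = c v \<and> c b = c v"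
    and "\<And>a b y z. {a, b, y, z} \<subseteq> A - c -` B \<Longrightarrow> c a = c b \<Longrightarrow> \<not> induced_4_cycle E a b y z"
  shows "real (card (compatible_sets E c A)) \<le> (3 / 2) ^ card B * real (card (MI E A))"
  using assms
proof (induction B arbitrary: A rule: finite_induct)
  case empty
  then show ?case using card_compatible_sets_le_MI[of A c] by simp
next
  case (insert k B)
  let ?F = "compatible_sets E c"
  show ?case
  proof (cases "\<exists>v\<in>A. c v = k")
    \<comment> \<open>A class of \<open>B\<close> may have vanished with the neighbourhood of
      another one; its factor is at least 1.\<close>
    case False
    then have "A - c -` insert k B = A - c -` B" by auto
    then have "real (card (?F A)) \<le> (3 / 2) ^ card B * real (card (MI E A))"
      using insert.prems by (intro insert.IH) auto
    also have "\<dots> \<le> (3 / 2) ^ card (insert k B) * real (card (MI E A))"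
      using insert.hyps by (intro mult_right_mono power_increasing) auto
    finally show ?thesis .
  next
    case True
    then obtain a b where ab: "a \<in> A" "b \<in> A" "(a, b) \<in> E" "c a = k" "c b = k"
      using insert.prems(2) by blast
    let ?A1 = "A - {v. c v = k}" and ?A2 = "A - colour_neighbourhood E c A k"
    \<comment> \<open>\<open>X\<close> is a union of classes of \<open>A\<close>, so every class of
      \<open>B\<close> that meets \<open>X\<close> keeps its inner edge.\<close>
    have IH: "real (card (?F X)) \<le> (3 / 2) ^ card B * real (card (MI E X))"
      if X: "X \<subseteq> ?A1" "\<And>u v. u \<in> A \<Longrightarrow> v \<in> X \<Longrightarrow> c u = c v \<Longrightarrow> u \<in> X" for X
    proof (rule insert.IH)
      show "finite X" using X(1) insert.prems(1) by (auto intro: finite_subset)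
      show "\<exists>a\<in>X. \<exists>b\<in>X. (a, b) \<in> E \<and> c a = c v \<and> c b = c v" if "v \<in> X" "c v \<in> B" for v
      proof -
        have "\<exists>a\<in>A. \<exists>b\<in>A. (a, b) \<in> E \<and> c a = c v \<and> c b = c v"
          using that X(1) by (intro insert.prems(2)) auto
        then show ?thesis using X(2) that(1) by blast
      qed
      show "\<not> induced_4_cycle E a b y z" if "{a, b, y, z} \<subseteq> X - c -` B" "c a = c b" for a b y z
        by (rule insert.prems(3)) (use that X(1) in auto)
    qed
    have F1: "real (card (?F ?A1)) \<le> (3 / 2) ^ card B * real (card (MI E ?A1))"
      by (rule IH) auto
    have F2: "real (card (?F ?A2)) \<le> (3 / 2) ^ card B * real (card (MI E ?A2))"
      by (rule IH) (auto simp: colour_neighbourhood_def)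
    have "2 * card (MI E ?A2) \<le> card (MI E A)"
      by (rule card_MI_edge_half[OF insert.prems(1) _ ab(1-3)])
         (use ab colour_neighbourhood_avoids[of _ A c k] in auto)
    moreover have "card (MI E ?A1) \<le> card (MI E A)"
      by (rule card_MI_mono[OF insert.prems(1)]) auto
    ultimately have sum: "real (card (MI E ?A1)) + real (card (MI E ?A2)) \<le> 3 / 2 * real (card (MI E A))"
      by linarith
    have "real (card (?F A)) \<le> real (card (?F ?A1)) + real (card (?F ?A2))"
      using card_compatible_sets_split[OF insert.prems(1), of c k] by linarith
    also have "\<dots> \<le> (3 / 2) ^ card B * (real (card (MI E ?A1)) + real (card (MI E ?A2)))"
      using F1 F2 by (simp add: distrib_left)
    also have "\<dots> \<le> (3 / 2) ^ card B * (3 / 2 * real (card (MI E A)))"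
      using sum by (intro mult_left_mono) auto
    finally show ?thesis using insert.hyps by simp
  qed
qed

section \<open>Choice of the classes that are charged a factor 3/2\<close>

text \<open>
  Every class of \<open>B\<close> contains an edge of an induced 4-cycle whose opposite edge does not lie inside
  another class of \<open>B\<close>. To find \<open>B\<close>, call a class twinned with another one if they contain
  opposite edges of an induced 4-cycle. Among the classes for which all such cycles come from
  twins, let \<open>J\<close> be a maximal set of pairwise non-twinned ones, and put the rest into \<open>B\<close>.
\<close>

lemma colour_selection:
  assumes fin: "finite A"
  obtains B where "finite B"
    and "\<And>k. k \<in> B \<Longrightarrow> \<exists>a b y z. {a, b, y, z} \<subseteq> A \<and> induced_4_cycle E a b y z \<and>
      c a = k \<and> c b = k \<and> (c y = c z \<longrightarrow> c y = k \<or> c y \<notin> B)"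
    and "\<And>a b y z. {a, b, y, z} \<subseteq> A - c -` B \<Longrightarrow> c a = c b \<Longrightarrow> \<not> induced_4_cycle E a b y z"
proof -
  define cyc where "cyc k a b y z \<longleftrightarrow>
    {a, b, y, z} \<subseteq> A \<and> induced_4_cycle E a b y z \<and> c a = k \<and> c b = k" for k a b y z
  define K where "K = {k. \<exists>a b y z. cyc k a b y z}"
  \<comment> \<open>Such a cycle suits every choice of \<open>B\<close>: its opposite edge joins two
    classes or lies in class \<open>k\<close> itself.\<close>
  define own where "own k \<longleftrightarrow> (\<exists>a b y z. cyc k a b y z \<and> (c y = c z \<longrightarrow> c y = k))" for k
  define twin where "twin k l \<longleftrightarrow> (\<exists>a b y z. cyc k a b y z \<and> c y = l \<and> c z = l)" for k l
  let ?I = "{J. J \<subseteq> {k \<in> K. \<not> own k} \<and> (\<forall>k\<in>J. \<forall>l\<in>J. k \<noteq> l \<longrightarrow> \<not> twin k l)}"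
  have twin_sym: "twin l k" if tw: "twin k l" for k l
  proof -
    obtain a b y z where "cyc k a b y z" "c y = l" "c z = l" using tw unfolding twin_def by blast
    then have "cyc l y z a b" "c a = k" "c b = k"
      using induced_4_cycle_opposite unfolding cyc_def by auto
    then show ?thesis unfolding twin_def by blast
  qed
  have "K \<subseteq> c ` A" by (auto simp: K_def cyc_def)
  then have finK: "finite K" using fin by (rule finite_surj[rotated])
  have "finite ?I" by (rule finite_subset[of _ "Pow K"]) (use finK in auto)
  moreover have "{} \<in> ?I" by simp
  ultimately obtain J where J: "J \<in> ?I" "\<And>J'. J' \<in> ?I \<Longrightarrow> J \<subseteq> J' \<Longrightarrow> J = J'"
    using finite_has_maximal2[of ?I "{}"] by auto
  show thesis
  proof (rule that[of "K - J"])
    show "finite (K - J)" using finK by simp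
  next
    fix k assume k: "k \<in> K - J"
    have "\<exists>a b y z. cyc k a b y z \<and> (c y = c z \<longrightarrow> c y = k \<or> c y \<notin> K - J)"
    proof (cases "own k")
      case True
      then show ?thesis unfolding own_def by blast
    next
      case False
      \<comment> \<open>Maximality of \<open>J\<close> yields a twin of \<open>k\<close> in
        \<open>J\<close>, hence a cycle whose opposite edge lies in a class outside
        \<open>K - J\<close>.\<close>
      have "insert k J \<notin> ?I" using J(2)[of "insert k J"] k by auto
      then obtain l where "l \<in> J" "twin k l" using False J(1) k twin_sym by auto
      then show ?thesis unfolding twin_def by blast
    qed
    then show "\<exists>a b y z. {a, b, y, z} \<subseteq> A \<and> induced_4_cycle E a b y z \<and>
      c a = k \<and> c b = k \<and> (c y = c z \<longrightarrow> c y = k \<or> c y \<notin> K - J)"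
      unfolding cyc_def by blast
  next
    fix a b y z assume A: "{a, b, y, z} \<subseteq> A - c -` (K - J)" and ab: "c a = c b"
    show "\<not> induced_4_cycle E a b y z"
    proof
      assume C: "induced_4_cycle E a b y z"
      \<comment> \<open>The class of \<open>ab\<close> must be in \<open>J\<close>, so it is not
        \<open>own\<close> and \<open>yz\<close> lies in a different class. That class is in
        \<open>J\<close> as well, which gives twins inside \<open>J\<close>.\<close>
      then have cab: "cyc (c a) a b y z" using A ab by (auto simp: cyc_def)
      then have "c a \<in> J" using A by (auto simp: K_def)
      then have "\<not> own (c a)" using J(1) by auto
      then have yz: "c y = c z" "c y \<noteq> c a" using cab unfolding own_def by blast+
      then have "cyc (c y) y z a b"
        using A induced_4_cycle_opposite[OF C] by (auto simp: cyc_def)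
      then have "c y \<in> J" using A by (auto simp: K_def)
      moreover have "twin (c a) (c y)" unfolding twin_def using cab yz(1) by metis
      ultimately show False using J(1) yz(2) \<open>c a \<in> J\<close> by auto
    qed
  qed
qed

end

section \<open>Fixed points of conjunctive networks\<close>

context pair_graph
begin

lemma loopless_symmetric_parcs: "loopless_symmetric (parcs G)"
proof
  show "sym (parcs G)" using sym_arcs by (simp add: symmetric_def)
  show "irrefl (parcs G)" using pair_no_loops by (fastforce simp: irrefl_def)
qed

lemma maximal_independent_sets_eq_MI: "{S. maximal_independent_set G S} = MI (parcs G) (pverts G)"
proof -
  interpret loopless_symmetric "parcs G" by (rule loopless_symmetric_parcs)
  have "maximal_independent_set G S \<longleftrightarrow> S \<in> MI (parcs G) (pverts G)" for S
  proof
    assume S: "maximal_independent_set G S"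
    then have "S \<subseteq> pverts G" "\<And>u v. u \<in> S \<Longrightarrow> v \<in> S \<Longrightarrow> (u, v) \<notin> parcs G"
      by (auto simp: maximal_independent_set_def independent_set_def)
    then obtain T where T: "T \<in> MI (parcs G) (pverts G)" "S \<subseteq> T"
      using MI_extend[OF pair_finite_verts] by metis
    then have "T = S"
      using S by (auto simp: maximal_independent_set_def independent_set_def MI_def)
    with T(1) show "S \<in> MI (parcs G) (pverts G)" by simp
  next
    assume "S \<in> MI (parcs G) (pverts G)"
    then have "S \<subseteq> pverts G" "\<forall>u\<in>S. \<forall>v\<in>S. (u, v) \<notin> parcs G"
      "\<And>v. v \<in> pverts G \<Longrightarrow> v \<notin> S \<Longrightarrow> \<exists>u\<in>S. (u, v) \<in> parcs G"
      by (auto simp: MI_def)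
    then show "maximal_independent_set G S"
      unfolding maximal_independent_set_def independent_set_def by blast
  qed
  then show ?thesis by blast
qed

text \<open>A product vanishes iff one of its factors does, and all values involved are 0 or
  1.\<close>

lemma fixed_point_iff:
  assumes x: "x \<in> configurations G"
  shows "conjunctive_network G \<sigma> x = x \<longleftrightarrow> (\<forall>v\<in>pverts G. x v = 1 \<longleftrightarrow>
    (\<forall>u. (u, v) \<in> parcs G \<longrightarrow> x u = (if \<sigma> (u, v) = Positive then 1 else 0)))"
proof -
  let ?f = "conjunctive_network G \<sigma> x"
  have x01: "x u = 0 \<or> x u = 1" if "u \<in> pverts G" for u
    using x that by (auto simp: configurations_def)
  have f: "?f \<in> configurations G" by (rule conjunctive_network_configuration[OF x])
  then have f01: "?f v = 0 \<or> ?f v = 1" if "v \<in> pverts G" for v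
    using that by (auto simp: configurations_def)
  have "?f = x \<longleftrightarrow> (\<forall>v\<in>pverts G. ?f v = x v)"
    using f x by (auto simp: configurations_def intro: PiE_ext)
  also have "\<dots> \<longleftrightarrow> (\<forall>v\<in>pverts G. x v = 1 \<longleftrightarrow> ?f v \<noteq> 0)"
    using x01 f01 by (metis zero_neq_one)
  also have "\<dots> \<longleftrightarrow> (\<forall>v\<in>pverts G. x v = 1 \<longleftrightarrow>
    (\<forall>u. (u, v) \<in> parcs G \<longrightarrow> x u = (if \<sigma> (u, v) = Positive then 1 else 0)))"
  proof (rule ball_cong[OF refl])
    fix v assume v: "v \<in> pverts G"
    have fin: "finite {u. (u, v) \<in> parcs G \<and> P u}" for P
      by (rule finite_subset[OF _ pair_finite_verts]) (auto dest: in_arcsD1)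
    have neg: "s \<noteq> Positive \<longleftrightarrow> s = Negative" for s by (cases s) auto
    have "?f v \<noteq> 0 \<longleftrightarrow> (\<forall>u. (u, v) \<in> parcs G \<longrightarrow> (if \<sigma> (u, v) = Positive then x u \<noteq> 0 else x u \<noteq> 1))"
      using v by (auto simp: conjunctive_network_def fin neg[symmetric])
    also have "\<dots> \<longleftrightarrow> (\<forall>u. (u, v) \<in> parcs G \<longrightarrow> x u = (if \<sigma> (u, v) = Positive then 1 else 0))"
      using x01 in_arcsD1 by (metis zero_neq_one)
    finally show "(x v = 1 \<longleftrightarrow> ?f v \<noteq> 0) \<longleftrightarrow> (x v = 1 \<longleftrightarrow>
      (\<forall>u. (u, v) \<in> parcs G \<longrightarrow> x u = (if \<sigma> (u, v) = Positive then 1 else 0)))" by blast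
  qed
  finally show ?thesis .
qed

text \<open>With all signs negative, a vertex is 1 iff its neighbours are all 0. Indicators of
  maximal independent sets satisfy this by independence and domination.\<close>

lemma mis_le_max_fixed_points: "mis G \<le> max_fixed_points G"
proof -
  interpret loopless_symmetric "parcs G" by (rule loopless_symmetric_parcs)
  define \<sigma> where "\<sigma> = (\<lambda>e\<in>parcs G. Negative)"
  define g :: "'a set \<Rightarrow> 'a \<Rightarrow> int" where "g S = (\<lambda>v\<in>pverts G. of_bool (v \<in> S))" for S
  let ?X = "{x \<in> configurations G. conjunctive_network G \<sigma> x = x}"
  have \<sigma>: "\<sigma> \<in> sign_repartitions G" by (auto simp: \<sigma>_def sign_repartitions_def)
  have "card (MI (parcs G) (pverts G)) \<le> card ?X"
  proof (rule card_inj_on_le[of g])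
    show "inj_on g (MI (parcs G) (pverts G))"
    proof (rule inj_onI)
      fix S T assume ST: "S \<in> MI (parcs G) (pverts G)" "T \<in> MI (parcs G) (pverts G)" "g S = g T"
      have "v \<in> S \<longleftrightarrow> v \<in> T" if "v \<in> pverts G" for v
        using fun_cong[OF ST(3), of v] that by (auto simp: g_def of_bool_def split: if_splits)
      then show "S = T" using ST(1,2) by (auto simp: MI_def)
    qed
    show "g ` MI (parcs G) (pverts G) \<subseteq> ?X"
    proof (clarify, intro conjI)
      fix S assume S: "S \<in> MI (parcs G) (pverts G)"
      show g: "g S \<in> configurations G" by (auto simp: g_def configurations_def)
      have "(\<forall>u. (u, v) \<in> parcs G \<longrightarrow> g S u = (if \<sigma> (u, v) = Positive then 1 else 0)) \<longleftrightarrow>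
          (\<forall>u. (u, v) \<in> parcs G \<longrightarrow> u \<notin> S)" for v
        by (auto simp: g_def \<sigma>_def dest: in_arcsD1)
      moreover have "g S v = 1 \<longleftrightarrow> v \<in> S" if "v \<in> pverts G" for v
        using that by (simp add: g_def)
      moreover have "v \<in> S \<longleftrightarrow> (\<forall>u. (u, v) \<in> parcs G \<longrightarrow> u \<notin> S)" if "v \<in> pverts G" for v
        using S that unfolding MI_def by blast
      ultimately show "conjunctive_network G \<sigma> (g S) = g S"
        unfolding fixed_point_iff[OF g] by simp
    qed
    show "finite ?X" using finite_configurations by simp
  qed
  also have "\<dots> \<le> max_fixed_points G"
    unfolding max_fixed_points_def num_fixed_points_def[symmetric]
    by (rule Max_ge) (use \<sigma> finite_sign_repartitions in auto)
  finally show ?thesis by (simp add: mis_def maximal_independent_sets_eq_MI)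
qed

text \<open>If \<open>v\<close> is 1 in a fixed point, a neighbour \<open>u\<close> is 1 there
  exactly if the arc \<open>uv\<close> is positive. Adjacent ones therefore have positive arcs both
  ways, and such a pair of arcs forces equal values in all fixed points.\<close>

lemma num_fixed_points_compatible:
  obtains A and c :: "'a \<Rightarrow> 'a set set" where "A \<subseteq> pverts G"
    and "num_fixed_points G \<sigma> \<le> card (compatible_sets (parcs G) c A)"
proof -
  let ?X = "{x \<in> configurations G. conjunctive_network G \<sigma> x = x}"
  define ones where "ones x = {v \<in> pverts G. x v = 1}" for x :: "'a \<Rightarrow> int"
  define A where "A = \<Union> (ones ` ?X)"
  \<comment> \<open>Equal colour of two vertices means equal value in every fixed point.\<close>
  define c where "c v = {S \<in> ones ` ?X. v \<in> S}" for v
  have A: "A \<subseteq> pverts G" by (auto simp: A_def ones_def)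
  have rev: "(v, u) \<in> parcs G" if "(u, v) \<in> parcs G" for u v
    using that sym_arcs by (auto simp: symmetric_def dest: symD)
  have fp: "v \<in> ones x \<longleftrightarrow>
      (\<forall>u. (u, v) \<in> parcs G \<longrightarrow> x u = (if \<sigma> (u, v) = Positive then 1 else 0))"
    if "x \<in> ?X" "v \<in> pverts G" for x v
  proof -
    have "x \<in> configurations G" "conjunctive_network G \<sigma> x = x" using that(1) by auto
    then show ?thesis using fixed_point_iff that(2) by (auto simp: ones_def)
  qed
  have pos: "u \<in> ones x \<longleftrightarrow> \<sigma> (u, v) = Positive"
    if "x \<in> ?X" "v \<in> ones x" "(u, v) \<in> parcs G" for x u v
  proof -
    have "v \<in> pverts G" "u \<in> pverts G" using that(3) by (auto dest: in_arcsD1 in_arcsD2)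
    then show ?thesis using fp[OF that(1), of v] that(2,3) by (auto simp: ones_def)
  qed
  have equiv: "c u = c v"
    if e: "(u, v) \<in> parcs G" "\<sigma> (u, v) = Positive" "\<sigma> (v, u) = Positive" for u v
  proof -
    have "u \<in> ones x \<longleftrightarrow> v \<in> ones x" if x: "x \<in> ?X" for x
      using pos[OF x] e rev by blast
    then show ?thesis by (auto simp: c_def)
  qed
  have mem: "v \<in> ones x" if "x \<in> ?X" "u \<in> ones x" "c u = c v" for x u v
    using that unfolding c_def by blast
  have "ones x \<in> compatible_sets (parcs G) c A" if x: "x \<in> ?X" for x
    unfolding compatible_sets_def
  proof (intro CollectI conjI ballI impI)
    show "ones x \<subseteq> A" using x by (auto simp: A_def)
    show "v \<in> ones x" if "u \<in> ones x" "c u = c v" for u v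
      using mem[OF x that] .
    show "c u = c v" if "u \<in> ones x" "v \<in> ones x" "(u, v) \<in> parcs G" for u v
      using that pos[OF x] rev by (intro equiv) blast+
    fix v assume v: "v \<in> A - ones x"
    then obtain x' where x': "x' \<in> ?X" "v \<in> ones x'" by (auto simp: A_def)
    have "v \<in> pverts G" using v A by blast
    then obtain u where u: "(u, v) \<in> parcs G" "x u \<noteq> (if \<sigma> (u, v) = Positive then 1 else 0)"
      using fp[OF x] v by blast
    have uV: "u \<in> pverts G" using u(1) by (rule in_arcsD1)
    show "(\<exists>u\<in>ones x. (u, v) \<in> parcs G) \<or> (\<exists>u\<in>A. (u, v) \<in> parcs G \<and> c u = c v)"
    proof (cases "\<sigma> (u, v) = Positive")
      case True
      \<comment> \<open>In \<open>x'\<close> the vertex \<open>v\<close> is 1, so the positive arc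
        \<open>uv\<close> makes \<open>u\<close> equal to 1 there. Then \<open>vu\<close> is
        positive too, and \<open>u\<close> has the colour of \<open>v\<close>.\<close>
      then have "u \<in> ones x'" using pos[OF x' u(1)] by simp
      moreover have "\<sigma> (v, u) = Positive"
        using pos[OF x'(1) calculation rev[OF u(1)]] x'(2) by simp
      ultimately show ?thesis using equiv[OF u(1) True] x'(1) u(1) by (auto simp: A_def)
    next
      case False
      then have "x u = 1" using u(2) x uV by (auto simp: configurations_def)
      then show ?thesis using u(1) uV by (auto simp: ones_def)
    qed
  qed
  moreover have "inj_on ones ?X"
  proof (rule inj_onI)
    fix x y assume x: "x \<in> ?X" and y: "y \<in> ?X" and eq: "ones x = ones y"
    show "x = y"
    proof (rule PiE_ext)
      show "x \<in> pverts G \<rightarrow>\<^sub>E {0, 1}" "y \<in> pverts G \<rightarrow>\<^sub>E {0, 1}"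
        using x y by (auto simp: configurations_def)
      fix v assume v: "v \<in> pverts G"
      then have "x v \<in> {0, 1}" "y v \<in> {0, 1}" using x y by (auto simp: configurations_def)
      moreover have "x v = 1 \<longleftrightarrow> y v = 1" using eq v by (auto simp: ones_def)
      ultimately show "x v = y v" by auto
    qed
  qed
  ultimately have "num_fixed_points G \<sigma> \<le> card (compatible_sets (parcs G) c A)"
    unfolding num_fixed_points_def
    using finite_compatible_sets[OF finite_subset[OF A pair_finite_verts]]
    by (intro card_inj_on_le[of ones]) auto
  with A show thesis by (rule that)
qed

text \<open>One edge \<open>ab\<close> is chosen per class. Its ends carry the colour of the class,
  so edges of different classes are disjoint, and its cycle serves as the required induced
  copy.\<close>

lemma C4_matching_of_colours:
  assumes "A \<subseteq> pverts G"
    and B: "\<And>k. k \<in> B \<Longrightarrow> \<exists>a b y z. {a, b, y, z} \<subseteq> A \<and> induced_4_cycle (parcs G) a b y z \<and>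
      c a = k \<and> c b = k \<and> (c y = c z \<longrightarrow> c y = k \<or> c y \<notin> B)"
  shows "card B \<le> C4_matching_number G"
proof -
  interpret loopless_symmetric "parcs G" by (rule loopless_symmetric_parcs)
  obtain a b y z where cyc: "\<And>k. k \<in> B \<Longrightarrow> induced_4_cycle (parcs G) (a k) (b k) (y k) (z k) \<and>
      c (a k) = k \<and> c (b k) = k \<and> (c (y k) = c (z k) \<longrightarrow> c (y k) = k \<or> c (y k) \<notin> B)"
    using B by metis
  define e where "e k = {a k, b k}" for k
  have col: "c v = k" if "k \<in> B" "v \<in> e k" for k v
    using cyc[OF that(1)] that(2) by (auto simp: e_def)
  have inj: "inj_on e B"
  proof (rule inj_onI)
    fix k l assume kl: "k \<in> B" "l \<in> B" "e k = e l"
    have "a k \<in> e k" by (simp add: e_def)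
    then show "k = l" using col kl by metis
  qed
  have "C4_matching G (e ` B)"
    unfolding C4_matching_def matching_def
  proof (intro conjI ballI)
    show "e ` B \<subseteq> edges G"
      using cyc by (fastforce simp: e_def edges_def induced_4_cycle_def)
    have "disjnt (e k) (e l)" if "k \<in> B" "l \<in> B" "e k \<noteq> e l" for k l
      using that col unfolding disjnt_iff by metis
    then show "pairwise disjnt (e ` B)" unfolding pairwise_def by blast
    fix e1 assume "e1 \<in> e ` B"
    then obtain k where k: "k \<in> B" "e1 = e k" by blast
    let ?W = "{a k, b k, y k, z k}"
    define H where "H = \<lparr> pverts = ?W, parcs = parcs G \<inter> ?W \<times> ?W \<rparr>"
    have C: "induced_4_cycle (parcs G) (a k) (b k) (y k) (z k)"
      "c (a k) = k" "c (b k) = k" "c (y k) = c (z k) \<longrightarrow> c (y k) = k \<or> c (y k) \<notin> B"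
      using cyc[OF k(1)] by auto
    have "distinct [a k, b k, y k, z k]"
      using C(1) E_irrefl by (auto simp: induced_4_cycle_def)
    then have "induced_C4 H G"
      using C(1) unfolding induced_C4_iff H_def induced_4_cycle_def
      by (intro exI[of _ "a k"] exI[of _ "b k"] exI[of _ "y k"] exI[of _ "z k"]) auto
    moreover have "e1 \<in> edges H"
      using C(1) k by (auto simp: H_def edges_def e_def induced_4_cycle_def)
    moreover have "e2 = e1" if e2: "e2 \<in> e ` B" "e2 \<in> edges H" for e2
    proof -
      obtain l where l: "l \<in> B" "e2 = e l" using e2(1) by blast
      obtain u v where uv: "e2 = {u, v}" "u \<in> ?W" "v \<in> ?W" "(u, v) \<in> parcs G"
        using e2(2) by (auto simp: H_def edges_def)
      have cl: "c u = l" "c v = l" using col[OF l(1)] l(2) uv(1) by auto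
      have "u \<noteq> v" using uv(4) E_irrefl by auto
      \<comment> \<open>If \<open>l\<close> differed from \<open>k\<close>, then \<open>u\<close>
        and \<open>v\<close> could only be \<open>y k\<close> and \<open>z k\<close>. Both would
        have the colour \<open>l\<close> in \<open>B\<close>, which the choice of the cycle
        excludes.\<close>
      then have "l = k" using uv(2,3) cl C(2-4) l(1) by auto
      then show ?thesis using l k by simp
    qed
    ultimately show "\<exists>H. induced_C4 H G \<and> e1 \<in> edges H \<and> (\<forall>e'\<in>e ` B. e' \<in> edges H \<longrightarrow> e' = e1)"
      by blast
  qed
  then have "card (e ` B) \<le> C4_matching_number G"
    unfolding C4_matching_number_def by (intro Max_ge) (use finite_C4_matchings in auto)
  then show ?thesis using card_image[OF inj] by simp
qed

lemma num_fixed_points_le: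
  "real (num_fixed_points G \<sigma>) \<le> (3 / 2) ^ C4_matching_number G * real (mis G)"
proof -
  interpret loopless_symmetric "parcs G" by (rule loopless_symmetric_parcs)
  obtain A and c :: "'a \<Rightarrow> 'a set set" where A: "A \<subseteq> pverts G"
    and le: "num_fixed_points G \<sigma> \<le> card (compatible_sets (parcs G) c A)"
    by (rule num_fixed_points_compatible)
  have fin: "finite A" using A pair_finite_verts by (rule finite_subset)
  obtain B where B: "finite B"
    "\<And>k. k \<in> B \<Longrightarrow> \<exists>a b y z. {a, b, y, z} \<subseteq> A \<and> induced_4_cycle (parcs G) a b y z \<and>
      c a = k \<and> c b = k \<and> (c y = c z \<longrightarrow> c y = k \<or> c y \<notin> B)"
    "\<And>a b y z. {a, b, y, z} \<subseteq> A - c -` B \<Longrightarrow> c a = c b \<Longrightarrow> \<not> induced_4_cycle (parcs G) a b y z"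
    by (rule colour_selection[OF fin, of c]) (rule that)
  have "real (num_fixed_points G \<sigma>) \<le> (3 / 2) ^ card B * real (card (MI (parcs G) A))"
  proof (rule order_trans[OF _ card_compatible_sets_le[OF B(1) fin _ B(3)]])
    show "\<exists>a\<in>A. \<exists>b\<in>A. (a, b) \<in> parcs G \<and> c a = c v \<and> c b = c v" if "c v \<in> B" for v
      using B(2)[OF that] by (auto simp: induced_4_cycle_def)
  qed (use le in auto)
  also have "\<dots> \<le> (3 / 2) ^ C4_matching_number G * real (mis G)"
  proof (intro mult_mono power_increasing)
    show "card B \<le> C4_matching_number G" by (rule C4_matching_of_colours[OF A B(2)])
    show "real (card (MI (parcs G) A)) \<le> real (mis G)"
      using card_MI_mono[OF pair_finite_verts A] by (simp add: mis_def maximal_independent_sets_eq_MI)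
  qed auto
  finally show ?thesis .
qed

end

theorem theorem1:
  fixes G :: "'a pair_pre_digraph"
  assumes "pair_graph G"
  shows "mis G \<le> max_fixed_points G \<and>
    real (max_fixed_points G) \<le> (3 / 2) ^ C4_matching_number G * real (mis G)"
proof
  interpret pair_graph G by (rule assms)
  show "mis G \<le> max_fixed_points G" by (rule mis_le_max_fixed_points)
  have "max_fixed_points G \<in> num_fixed_points G ` sign_repartitions G"
    unfolding max_fixed_points_def
    using finite_sign_repartitions sign_repartitions_nonempty by (intro Max_in) auto
  then show "real (max_fixed_points G) \<le> (3 / 2) ^ C4_matching_number G * real (mis G)"
    using num_fixed_points_le by auto
qed

end
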